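(* Let $S$ be an inverse semigroup with a pseudo-norm $\|\cdot\|$, endowed with the norm topology. Then the maps $x\mapsto x+y$ (for each $y\in S$) and $x\mapsto\|x\|$ are continuous. Moreover, if $\|\cdot\|$ is cyclically permutable, i.e. $\|x+y\|=\|y+x\|$ for all $x,y\in S$, then the maps $x\mapsto x^*$, $x\mapsto\delta(x)=x+x^*$, and $(x,y)\mapsto x+y$ are continuous, and $S$ becomes a topological inverse semigroup.
   Context: Semigroups are written additively but are not assumed commutative. A semigroup $(S,+)$ is inverse if every $x\in S$ has a unique $x^*\in S$ with $x+x^*+x=x$ and $x^*+x+x^*=x^*$. Write $\delta x:=x+x^*$. A pseudo-norm on an inverse semigroup $S$ is a map $\|\cdot\|:S\to\mathbb{R}_+$ such that for all $x,y,z\in S$: $\|x+y^*\|=\|y+x^*\|$; $\|x+x^*\|\leqslant\|x+y^*\|$; and $\|x+y^*\|+\|z+z^*\|\leqslant\|x+z^*\|+\|z+y^*\|$. The norm topology is the topology induced by the pseudo-metric $d_1(x,y)=\|x+y^*\|-\frac{\|\delta x\|+\|\delta y\|}{2}$. A topological inverse semigroup is an inverse semigroup with a topology for which addition (jointly) and $x\mapsto x^*$ are continuous. *)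

theory Defs
  imports "HOL-Analysis.Analysis"
begin

class inverse_semigroup_add = semigroup_add +
  assumes ex1_star: "\<exists>!y. x + y + x = x \<and> y + x + y = y"

definition star :: "'a::inverse_semigroup_add \<Rightarrow> 'a"
  where "star x = (THE y. x + y + x = x \<and> y + x + y = y)"

lemma star_works: "x + star x + x = x" "star x + x + star x = star x"
  using theI'[OF ex1_star[of x]] unfolding star_def by blast+

lemma star_unique: "x + y + x = x \<Longrightarrow> y + x + y = y \<Longrightarrow> star x = y"
  using ex1_star[of x] star_works[of x] by blast

definition delta :: "'a::inverse_semigroup_add \<Rightarrow> 'a"
  where "delta x = x + star x"

locale pseudo_norm =
  fixes N :: "'a::inverse_semigroup_add \<Rightarrow> real"
  assumes nonneg: "0 \<le> N x"
    and sym: "N (x + star y) = N (y + star x)"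
    and diag_le: "N (x + star x) \<le> N (x + star y)"
    and triangle: "N (x + star y) + N (z + star z) \<le> N (x + star z) + N (z + star y)"

definition norm_dist :: "('a::inverse_semigroup_add \<Rightarrow> real) \<Rightarrow> 'a \<Rightarrow> 'a \<Rightarrow> real"
  where "norm_dist N x y = N (x + star y) - (N (delta x) + N (delta y)) / 2"

lemma (in pseudo_norm) norm_dist_pseudometric:
  shows "0 \<le> norm_dist N x y" "norm_dist N x x = 0" "norm_dist N x y = norm_dist N y x"
    "norm_dist N x z \<le> norm_dist N x y + norm_dist N y z"
  using diag_le[of x y] diag_le[of y x] sym[of x y] triangle[of x z y]
  by (simp_all add: norm_dist_def delta_def field_simps)

(* HOL-Analysis provides the topology of a metric (Metric_space.mtopology) but not of a
   pseudo-metric; this is the same construction, for a distance defined on a whole type. *)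
definition pseudometric_topology :: "('a \<Rightarrow> 'a \<Rightarrow> real) \<Rightarrow> 'a topology"
  where "pseudometric_topology d =
    topology (\<lambda>U. \<forall>x\<in>U. \<exists>r>0. {y. d x y < r} \<subseteq> U)"

lemma openin_pseudometric_topology:
  "openin (pseudometric_topology d) U \<longleftrightarrow> (\<forall>x\<in>U. \<exists>r>0. {y. d x y < r} \<subseteq> U)"
proof -
  have "istopology (\<lambda>U. \<forall>x\<in>U. \<exists>r>0. {y. d x y < r} \<subseteq> U)"
    unfolding istopology_def
  proof (intro conjI allI impI ballI)
    fix S T x
    assume "\<forall>x\<in>S. \<exists>r>0. {y. d x y < r} \<subseteq> S" "\<forall>x\<in>T. \<exists>r>0. {y. d x y < r} \<subseteq> T" "x \<in> S \<inter> T"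
    then obtain r s where "r > 0" "s > 0" "{y. d x y < r} \<subseteq> S" "{y. d x y < s} \<subseteq> T"
      by blast
    then show "\<exists>r>0. {y. d x y < r} \<subseteq> S \<inter> T"
      by (intro exI[of _ "min r s"]) auto
  next
    fix K x
    assume *: "\<forall>S\<in>K. \<forall>x\<in>S. \<exists>r>0. {y. d x y < r} \<subseteq> S" and "x \<in> \<Union>K"
    then obtain S where "S \<in> K" "x \<in> S" by blast
    with * obtain r where "r > 0" "{y. d x y < r} \<subseteq> S" by blast
    with \<open>S \<in> K\<close> show "\<exists>r>0. {y. d x y < r} \<subseteq> \<Union>K" by blast
  qed
  then show ?thesis
    by (simp add: pseudometric_topology_def topology_inverse')
qed

lemma topspace_pseudometric_topology: "topspace (pseudometric_topology d) = UNIV"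
proof -
  have "openin (pseudometric_topology d) UNIV"
    unfolding openin_pseudometric_topology by (auto intro: exI[of _ 1])
  then show ?thesis
    using openin_subset by blast
qed

definition norm_topology :: "('a::inverse_semigroup_add \<Rightarrow> real) \<Rightarrow> 'a topology"
  where "norm_topology N = pseudometric_topology (norm_dist N)"

definition cyclically_permutable :: "('a::inverse_semigroup_add \<Rightarrow> real) \<Rightarrow> bool"
  where "cyclically_permutable N \<longleftrightarrow> (\<forall>x y. N (x + y) = N (y + x))"

(* No separation axiom is required. *)
definition topological_inverse_semigroup :: "'a::inverse_semigroup_add topology \<Rightarrow> bool"
  where "topological_inverse_semigroup T \<longleftrightarrow>
    topspace T = UNIV \<and>
    continuous_map (prod_topology T T) T (\<lambda>(x, y). x + y) \<and>
    continuous_map T T star"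

end

theory Submission
  imports Defs
begin

text \<open>
  Specialising the triangle axiom gives, for every \<open>s\<close>,
  \<open>N (x + s + y\<^sup>*) - N (x + s + x\<^sup>*) \<le> N (x + y\<^sup>*) - N (x + x\<^sup>*)\<close>. With \<open>s = a + a\<^sup>*\<close> this makes right
  translation by \<open>a\<close> nonexpansive, and together with \<open>N x \<le> N (x + e)\<close> for idempotent \<open>e\<close> the same
  axiom makes \<open>N\<close> 2-Lipschitz. If \<open>N\<close> is cyclically permutable then \<open>x \<mapsto> x\<^sup>*\<close> is an isometry, so left
  translations are nonexpansive as well and addition is nonexpansive for the sum distance.
\<close>

section \<open>Inverse semigroups\<close>

lemma star_star [simp]: "star (star x) = x"
  by (intro star_unique star_works)

lemma star_idem:
  assumes "e + e = e"
  shows "star e = e"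
  using assms by (intro star_unique) simp_all

text \<open>Let \<open>g\<close> be the inverse of \<open>e + f\<close>. Since
  \<open>f + g + e\<close> is also an inverse of \<open>e + f\<close>, uniqueness gives
  \<open>g = f + g + e\<close>, and this form makes \<open>g\<close> idempotent. An idempotent is
  its own inverse, so \<open>g = star g = e + f\<close>.\<close>

lemma idem_add_idem:
  fixes e f :: "'a::inverse_semigroup_add"
  assumes e: "e + e = e" and f: "f + f = f"
  shows "(e + f) + (e + f) = e + f"
proof -
  define g where "g = star (e + f)"
  have e': "e + (e + x) = e + x" and f': "f + (f + x) = f + x" for x
    using e f by (metis add.assoc)+
  have g1: "e + (f + (g + (e + f))) = e + f" and g2: "g + (e + (f + g)) = g"
    using star_works[of "e + f"] by (simp_all add: g_def add.assoc)
  have g2': "g + (e + (f + (g + x))) = g + x" for x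
    using g2 by (metis add.assoc)
  have "star (e + f) = f + g + e"
    by (rule star_unique) (simp_all add: add.assoc e' f' g1 g2')
  then have g: "g = f + (g + e)"
    by (simp add: g_def add.assoc)
  have "g + g = (f + (g + e)) + (f + (g + e))"
    using g by simp
  also have "\<dots> = f + (g + e)"
    by (simp add: add.assoc g2')
  finally have "g + g = g"
    using g by simp
  then show ?thesis
    using star_idem[of g] by (simp add: g_def)
qed

text \<open>Both \<open>f + e\<close> and \<open>e + f\<close> itself are inverses of the idempotent
  \<open>e + f\<close>, so uniqueness identifies them.\<close>

lemma idem_commute:
  fixes e f :: "'a::inverse_semigroup_add"
  assumes e: "e + e = e" and f: "f + f = f"
  shows "e + f = f + e"
proof -
  have e': "e + (e + x) = e + x" and f': "f + (f + x) = f + x" for x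
    using e f by (metis add.assoc)+
  have "star (e + f) = f + e"
    using idem_add_idem[OF e f] idem_add_idem[OF f e]
    by (intro star_unique) (simp_all add: add.assoc e' f')
  moreover have "star (e + f) = e + f"
    by (rule star_idem[OF idem_add_idem[OF e f]])
  ultimately show ?thesis
    by simp
qed

lemma idem_delta: "delta x + delta x = delta x"
  using star_works(1)[of x] by (metis add.assoc delta_def)

lemma delta_add: "delta x + x = x"
  by (simp add: delta_def star_works)

lemma add_delta_star: "x + delta (star x) = x"
  using star_works(1)[of x] by (simp add: delta_def add.assoc)

lemma star_delta [simp]: "star (delta x) = delta x"
  by (rule star_idem[OF idem_delta])

text \<open>In both defining equations the middle of the sum is made of the idempotents
  \<open>delta y\<close> and \<open>delta (star x)\<close>; once they are swapped, each is absorbed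
  by its outer neighbour.\<close>

lemma star_add: "star (x + y) = star y + star x"
proof -
  have c: "delta y + delta (star x) = delta (star x) + delta y"
    by (rule idem_commute[OF idem_delta idem_delta])
  have "x + y + (star y + star x) + (x + y) = x + (delta y + delta (star x)) + y"
    by (simp add: delta_def add.assoc)
  also have "\<dots> = (x + delta (star x)) + (delta y + y)"
    unfolding c by (simp add: add.assoc)
  finally have 1: "x + y + (star y + star x) + (x + y) = x + y"
    by (simp add: delta_add add_delta_star)
  have "star y + star x + (x + y) + (star y + star x) = star y + (delta (star x) + delta y) + star x"
    by (simp add: delta_def add.assoc)
  \<comment> \<open>\<open>delta y\<close> is written as \<open>delta (star (star y))\<close> so
    that \<open>add_delta_star\<close> applies to \<open>star y\<close>.\<close>
  also have "\<dots> = (star y + delta (star (star y))) + (delta (star x) + star x)"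
    unfolding c[symmetric] by (simp add: add.assoc)
  finally have "star y + star x + (x + y) + (star y + star x) = star y + star x"
    by (simp add: delta_add add_delta_star del: star_star)
  with 1 show ?thesis
    by (rule star_unique)
qed

section \<open>Pseudo-metric topologies\<close>

text \<open>Lets the Lipschitz criterion below apply to the real-valued map \<open>N\<close> as
  well.\<close>

lemma euclidean_eq_pseudometric_topology:
  "(euclidean :: 'a::metric_space topology) = pseudometric_topology dist"
  by (simp add: topology_eq openin_pseudometric_topology open_dist subset_eq dist_commute)

lemma continuous_map_pseudometric_Lipschitz:
  assumes "C > 0" and le: "\<And>x y. d' (f x) (f y) \<le> C * d x y"
  shows "continuous_map (pseudometric_topology d) (pseudometric_topology d') f"
  unfolding continuous_map topspace_pseudometric_topology
proof (intro conjI allI impI)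
  fix U assume U: "openin (pseudometric_topology d') U"
  show "openin (pseudometric_topology d) {x \<in> UNIV. f x \<in> U}"
    unfolding openin_pseudometric_topology
  proof
    fix x assume "x \<in> {x \<in> UNIV. f x \<in> U}"
    then obtain r where r: "r > 0" "{y. d' (f x) y < r} \<subseteq> U"
      using U by (auto simp: openin_pseudometric_topology)
    have "d' (f x) (f y) < r" if "d x y < r / C" for y
      using that le[of x y] \<open>C > 0\<close> by (simp add: field_simps)
    with r \<open>C > 0\<close> show "\<exists>r>0. {y. d x y < r} \<subseteq> {x \<in> UNIV. f x \<in> U}"
      by (intro exI[of _ "r / C"]) auto
  qed
qed simp

lemma openin_pseudometric_ball:
  assumes "\<And>x y z. d x z \<le> d x y + d y z"
  shows "openin (pseudometric_topology d) {y. d x y < r}"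
  unfolding openin_pseudometric_topology
proof
  fix y assume "y \<in> {y. d x y < r}"
  moreover have "d x z < r" if "d y z < r - d x y" for z
    using that assms[of x z y] by linarith
  ultimately show "\<exists>s>0. {z. d y z < s} \<subseteq> {y. d x y < r}"
    by (intro exI[of _ "r - d x y"]) auto
qed

text \<open>A box of two balls of radius \<open>r / 2\<close> maps into the ball of radius
  \<open>r\<close>. The triangle inequalities make its sides open, and zero self-distance puts the
  centre in it.\<close>

lemma continuous_map_prod_pseudometric_nonexpansive:
  assumes refl: "\<And>x. d x x = 0" and tri: "\<And>x y z. d x z \<le> d x y + d y z"
    and refl': "\<And>x. d' x x = 0" and tri': "\<And>x y z. d' x z \<le> d' x y + d' y z"
    and le: "\<And>x y a b. e (f (x, a)) (f (y, b)) \<le> d x y + d' a b"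
  shows "continuous_map (prod_topology (pseudometric_topology d) (pseudometric_topology d'))
    (pseudometric_topology e) f"
  unfolding continuous_map topspace_prod_topology topspace_pseudometric_topology
proof (intro conjI allI impI)
  fix U assume U: "openin (pseudometric_topology e) U"
  show "openin (prod_topology (pseudometric_topology d) (pseudometric_topology d'))
    {p \<in> UNIV \<times> UNIV. f p \<in> U}"
    unfolding openin_prod_topology_alt
  proof (intro allI impI)
    fix x a assume "(x, a) \<in> {p \<in> UNIV \<times> UNIV. f p \<in> U}"
    then obtain r where r: "r > 0" "{z. e (f (x, a)) z < r} \<subseteq> U"
      using U by (auto simp: openin_pseudometric_topology)
    have "e (f (x, a)) (f (y, b)) < r" if "d x y < r / 2" "d' a b < r / 2" for y b
      using that le[of x a y b] by linarith
    with r have "{y. d x y < r / 2} \<times> {b. d' a b < r / 2} \<subseteq> {p \<in> UNIV \<times> UNIV. f p \<in> U}"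
      by auto
    moreover have "openin (pseudometric_topology d) {y. d x y < r / 2}"
      "openin (pseudometric_topology d') {b. d' a b < r / 2}"
      by (rule openin_pseudometric_ball; fact tri tri')+
    moreover have "x \<in> {y. d x y < r / 2}" "a \<in> {b. d' a b < r / 2}"
      using r refl refl' by simp_all
    ultimately show "\<exists>V W. openin (pseudometric_topology d) V \<and>
        openin (pseudometric_topology d') W \<and> x \<in> V \<and> a \<in> W \<and>
        V \<times> W \<subseteq> {p \<in> UNIV \<times> UNIV. f p \<in> U}"
      by blast
  qed
qed simp

section \<open>Lipschitz estimates\<close>

context pseudo_norm
begin

text \<open>Every \<open>b\<close> has the form \<open>star y\<close>, namely with
  \<open>y = star b\<close>, so the triangle axiom also controls sums without a star.\<close>

lemma N_add_diff_le: "N (x + b) - N (z + b) \<le> N (x + star z) - N (delta z)"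
  using triangle[of x "star b" z] by (simp add: delta_def)

lemma N_sandwich_diff_le:
  "N (x + s + star y) - N (x + s + star x) \<le> N (x + star y) - N (delta x)"
  using triangle[of "x + s" y x] by (simp add: delta_def)

lemma N_le_add_idem:
  assumes "e + e = e"
  shows "N x \<le> N (x + e)"
proof -
  define p where "p = delta (star x)"
  have p: "p + p = p" "x + p = x"
    by (simp_all add: p_def idem_delta add_delta_star)
  \<comment> \<open>Replacing \<open>e\<close> by \<open>p + e\<close> leaves \<open>x + e\<close>
    unchanged and gives \<open>f + p = f\<close>. In the triangle axiom for \<open>x\<close>,
    \<open>p\<close>, \<open>f\<close> the terms \<open>N (f + star f)\<close> and
    \<open>N (f + star p)\<close> are then both \<open>N f\<close> and cancel.\<close>
  define f where "f = p + e"
  have f: "f + f = f" "f + p = f" "x + f = x + e"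
    using idem_add_idem[OF p(1) assms] idem_commute[OF p(1) assms] p
    by (simp_all add: f_def) (metis add.assoc)+
  have "star p = p" "star f = f"
    using p f by (simp_all add: star_idem)
  then show ?thesis
    using triangle[of x p f] p f by simp
qed

text \<open>\<open>x + a + star (y + a)\<close> equals \<open>x + delta a + star y\<close>, so the
  claim is the average of the two sandwich estimates for \<open>(x, y)\<close> and
  \<open>(y, x)\<close>.\<close>

lemma norm_dist_add_right: "norm_dist N (x + a) (y + a) \<le> norm_dist N x y"
  using N_sandwich_diff_le[of x "delta a" y] N_sandwich_diff_le[of y "delta a" x]
    sym[of "x + a" "y + a"] sym[of x y]
  by (simp add: norm_dist_def delta_def star_add add.assoc field_simps)

lemma N_diff_le_norm_dist: "N x - N z \<le> 2 * norm_dist N x z"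
proof -
  have "N x \<le> N (x + delta (star z))"
    by (intro N_le_add_idem idem_delta)
  \<comment> \<open>The idempotent \<open>delta (star z)\<close> is chosen because \<open>z\<close>
    absorbs it on the right.\<close>
  moreover have "N (x + delta (star z)) - N z \<le> N (x + star z) - N (delta z)"
    using N_add_diff_le[of x "delta (star z)" z] by (simp add: add_delta_star)
  \<comment> \<open>Twice the distance is the sum of the gaps
    \<open>N (x + star z) - N (delta x)\<close> and \<open>N (x + star z) - N (delta z)\<close>.
    Both are nonnegative, so it bounds the second one; hence the factor 2.\<close>
  moreover have "N (delta x) \<le> N (x + star z)" "N (delta z) \<le> N (x + star z)"
    using diag_le[of x z] diag_le[of z x] sym[of x z] by (simp_all add: delta_def)
  ultimately show ?thesis
    by (simp add: norm_dist_def field_simps)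
qed

lemma dist_N_le: "dist (N x) (N y) \<le> 2 * norm_dist N x y"
  using N_diff_le_norm_dist[of x y] N_diff_le_norm_dist[of y x] norm_dist_pseudometric(3)[of x y]
  by (simp add: dist_real_def abs_le_iff)

lemma norm_dist_star:
  assumes "cyclically_permutable N"
  shows "norm_dist N (star x) (star y) = norm_dist N x y"
proof -
  have "N (star u + v) = N (v + star u)" for u v
    using assms by (simp add: cyclically_permutable_def)
  then show ?thesis
    using sym[of x y] by (simp add: norm_dist_def delta_def)
qed

text \<open>The isometry \<open>star\<close> reverses sums, so it turns left translation by
  \<open>a\<close> into right translation by \<open>star a\<close>.\<close>

lemma norm_dist_add_left:
  assumes "cyclically_permutable N"
  shows "norm_dist N (a + x) (a + y) \<le> norm_dist N x y"
  using norm_dist_add_right[of "star x" "star a" "star y"]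
  by (simp add: norm_dist_star[OF assms] flip: star_add)

text \<open>Pass through \<open>y + a\<close>, changing one summand at a time.\<close>

lemma norm_dist_add:
  assumes "cyclically_permutable N"
  shows "norm_dist N (x + a) (y + b) \<le> norm_dist N x y + norm_dist N a b"
  using norm_dist_pseudometric(4)[of "x + a" "y + b" "y + a"] norm_dist_add_right[of x a y]
    norm_dist_add_left[OF assms, of y a b]
  by linarith

lemma norm_dist_delta:
  assumes "cyclically_permutable N"
  shows "norm_dist N (delta x) (delta y) \<le> 2 * norm_dist N x y"
  using norm_dist_add[OF assms, of x "star x" y "star y"] by (simp add: delta_def norm_dist_star[OF assms])

end

theorem corollary6p16:
  fixes N :: "'a::inverse_semigroup_add \<Rightarrow> real"
  assumes "pseudo_norm N"
  shows "(\<forall>y. continuous_map (norm_topology N) (norm_topology N) (\<lambda>x. x + y)) \<and>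
    continuous_map (norm_topology N) euclideanreal N \<and>
    (cyclically_permutable N \<longrightarrow>
      continuous_map (norm_topology N) (norm_topology N) star \<and>
      continuous_map (norm_topology N) (norm_topology N) delta \<and>
      continuous_map (prod_topology (norm_topology N) (norm_topology N)) (norm_topology N)
        (\<lambda>(x, y). x + y) \<and>
      topological_inverse_semigroup (norm_topology N))"
proof -
  interpret pseudo_norm N
    by fact
  have "continuous_map (norm_topology N) (norm_topology N) (\<lambda>x. x + y)" for y
    unfolding norm_topology_def
    by (rule continuous_map_pseudometric_Lipschitz[of 1]) (simp_all add: norm_dist_add_right)
  moreover have "continuous_map (norm_topology N) euclideanreal N"
    unfolding norm_topology_def euclidean_eq_pseudometric_topology
    by (rule continuous_map_pseudometric_Lipschitz[of 2]) (simp_all add: dist_N_le)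
  moreover {
    assume cyc: "cyclically_permutable N"
    have "continuous_map (norm_topology N) (norm_topology N) star"
      unfolding norm_topology_def
      by (rule continuous_map_pseudometric_Lipschitz[of 1]) (simp_all add: norm_dist_star[OF cyc])
    moreover have "continuous_map (norm_topology N) (norm_topology N) delta"
      unfolding norm_topology_def
      by (rule continuous_map_pseudometric_Lipschitz[of 2]) (simp_all add: norm_dist_delta[OF cyc])
    moreover have "continuous_map (prod_topology (norm_topology N) (norm_topology N))
        (norm_topology N) (\<lambda>(x, y). x + y)"
      unfolding norm_topology_def
      by (rule continuous_map_prod_pseudometric_nonexpansive)
        (simp_all add: norm_dist_pseudometric(2,4) norm_dist_add[OF cyc])
    ultimately have "continuous_map (norm_topology N) (norm_topology N) star \<and>
      continuous_map (norm_topology N) (norm_topology N) delta \<and>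
      continuous_map (prod_topology (norm_topology N) (norm_topology N)) (norm_topology N)
        (\<lambda>(x, y). x + y) \<and>
      topological_inverse_semigroup (norm_topology N)"
      by (simp add: topological_inverse_semigroup_def norm_topology_def
          topspace_pseudometric_topology)
  }
  ultimately show ?thesis
    by blast
qed

end
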